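(* Let $\rho$ be a weakly outer-continuous size function on a topological space $E$. Then the following properties hold: (1) $E$ is locally bounded with respect to the bornology of $\rho$-bounded subsets. (2) If $\rho$ is total, then the relatively compact subsets of $E$ are totally $\rho$-bounded. (3) If $\rho$ is total and $E$ is locally compact, then $E$ is locally bounded with respect to the bornology of totally $\rho$-bounded subsets.
   Context: $\overline{\mathbb{R}}_+ = \mathbb{R}_+ \cup \{\infty\}$, where $\mathbb{R}_+$ is the set of nonnegative real numbers. No separation axiom is assumed on topological spaces. A size function on a set $E$ is a map $\rho : 2^E \to \overline{\mathbb{R}}_+$ such that $\rho(\emptyset) = 0$; $\rho(\{x\}) < \infty$ for all $x \in E$; and $\rho(A) \leqslant \rho(A')$ for all subsets $A \subseteq A'$ of $E$. The number $\rho(A)$ is called the size of $A$. The size function $\rho$ is total if $\rho(\{x\}) = 0$ for all $x \in E$. The monk of $\rho$ is the map $\rho^{\circ}$ on $2^E$ defined by $\rho^{\circ}(A) = \inf\{ t > 0 : A \text{ is covered by finitely many subsets of } E \text{ of size } \leqslant t \}$, with $\inf \emptyset = \infty$. A subset $A$ of $E$ is $\rho$-bounded if $\rho^{\circ}(A) < \infty$, and totally $\rho$-bounded if $\rho^{\circ}(A) = 0$. If $E$ is a topological space, $\rho^{+}$ is the map on $2^E$ defined by $\rho^{+}(A) = \inf_{G \supseteq A} \rho(G)$, where $G$ runs over the open subsets of $E$ containing $A$. The size function $\rho$ is weakly outer-continuous if $\rho(K) = \rho^{+}(K)$ for all compact subsets $K$ of $E$. A subset of $E$ is relatively compact if it is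 included in a compact subset of $E$. A bornology on a set $E$ is a collection $\mathcal{B}$ of subsets of $E$ (called bounded subsets) that covers $E$, is closed under binary unions, and contains every subset of each of its elements. The $\rho$-bounded subsets form a bornology on $E$, and if $\rho$ is total the totally $\rho$-bounded subsets form a bornology on $E$. A topological space $E$ equipped with a bornology $\mathcal{B}$ is locally bounded if, for every $x \in E$ and every open subset $G$ with $x \in G$, there exists a neighborhood $B$ of $x$ such that $B \in \mathcal{B}$ and $B \subseteq G$. *)

theory Defs
  imports "HOL-Analysis.Analysis"
begin

text \<open>
  A size function on \<open>E\<close> is represented by a map on all sets of the ambient type; only its values
  on subsets of \<open>E\<close> are constrained.
\<close>

definition size_function :: "'a set \<Rightarrow> ('a set \<Rightarrow> ennreal) \<Rightarrow> bool" where
  "size_function E \<rho> \<longleftrightarrow>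
     \<rho> {} = 0 \<and>
     (\<forall>x\<in>E. \<rho> {x} < \<infinity>) \<and>
     (\<forall>A A'. A \<subseteq> A' \<and> A' \<subseteq> E \<longrightarrow> \<rho> A \<le> \<rho> A')"

definition total_size :: "'a set \<Rightarrow> ('a set \<Rightarrow> ennreal) \<Rightarrow> bool" where
  "total_size E \<rho> \<longleftrightarrow> (\<forall>x\<in>E. \<rho> {x} = 0)"

text \<open>In \<^typ>\<open>ennreal\<close> the infimum of the empty set is \<open>\<infinity>\<close>.\<close>

definition monk :: "'a set \<Rightarrow> ('a set \<Rightarrow> ennreal) \<Rightarrow> 'a set \<Rightarrow> ennreal" where
  "monk E \<rho> A =
     Inf {t. 0 < t \<and> t < \<infinity> \<and>
       (\<exists>\<F>. finite \<F> \<and> (\<forall>B\<in>\<F>. B \<subseteq> E \<and> \<rho> B \<le> t) \<and> A \<subseteq> \<Union>\<F>)}"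

definition bounded_subsets :: "'a set \<Rightarrow> ('a set \<Rightarrow> ennreal) \<Rightarrow> 'a set set" where
  "bounded_subsets E \<rho> = {A. A \<subseteq> E \<and> monk E \<rho> A < \<infinity>}"

definition totally_bounded_subsets :: "'a set \<Rightarrow> ('a set \<Rightarrow> ennreal) \<Rightarrow> 'a set set" where
  "totally_bounded_subsets E \<rho> = {A. A \<subseteq> E \<and> monk E \<rho> A = 0}"

definition outer_size :: "'a topology \<Rightarrow> ('a set \<Rightarrow> ennreal) \<Rightarrow> 'a set \<Rightarrow> ennreal" where
  "outer_size X \<rho> A = (INF G\<in>{G. openin X G \<and> A \<subseteq> G}. \<rho> G)"

definition weakly_outer_continuous :: "'a topology \<Rightarrow> ('a set \<Rightarrow> ennreal) \<Rightarrow> bool" where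
  "weakly_outer_continuous X \<rho> \<longleftrightarrow> (\<forall>K. compactin X K \<longrightarrow> \<rho> K = outer_size X \<rho> K)"

definition relatively_compactin :: "'a topology \<Rightarrow> 'a set \<Rightarrow> bool" where
  "relatively_compactin X A \<longleftrightarrow> (\<exists>K. compactin X K \<and> A \<subseteq> K)"

definition bornology :: "'a set \<Rightarrow> 'a set set \<Rightarrow> bool" where
  "bornology E \<B> \<longleftrightarrow>
     \<Union>\<B> = E \<and>
     (\<forall>A\<in>\<B>. \<forall>B\<in>\<B>. A \<union> B \<in> \<B>) \<and>
     (\<forall>B\<in>\<B>. \<forall>A. A \<subseteq> B \<longrightarrow> A \<in> \<B>)"

lemma bornologyI:
  assumes "\<And>B. B \<in> \<B> \<Longrightarrow> B \<subseteq> E"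
    and "\<And>x. x \<in> E \<Longrightarrow> {x} \<in> \<B>"
    and "\<And>A B. A \<in> \<B> \<Longrightarrow> B \<in> \<B> \<Longrightarrow> A \<union> B \<in> \<B>"
    and "\<And>A B. B \<in> \<B> \<Longrightarrow> A \<subseteq> B \<Longrightarrow> A \<in> \<B>"
  shows "bornology E \<B>"
proof -
  have "\<Union>\<B> = E"
    using assms(1,2) by blast
  then show ?thesis
    unfolding bornology_def by (metis assms(3,4))
qed

text \<open>
  \<open>neighbourhood_base_of P X\<close> says that every open set around a point contains a neighbourhood,
  not necessarily open, of that point satisfying \<open>P\<close>.
\<close>

definition locally_bounded :: "'a topology \<Rightarrow> 'a set set \<Rightarrow> bool" where
  "locally_bounded X \<B> \<longleftrightarrow> neighbourhood_base_of (\<lambda>B. B \<in> \<B>) X"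

lemma monk_mono: "A \<subseteq> A' \<Longrightarrow> monk E \<rho> A \<le> monk E \<rho> A'"
  unfolding monk_def by (rule Inf_superset_mono, rule Collect_mono) (meson order_trans)

lemma monk_less_iff:
  "monk E \<rho> A < s \<longleftrightarrow> (\<exists>t. 0 < t \<and> t < \<infinity> \<and> t < s \<and>
     (\<exists>\<F>. finite \<F> \<and> (\<forall>B\<in>\<F>. B \<subseteq> E \<and> \<rho> B \<le> t) \<and> A \<subseteq> \<Union>\<F>))"
  unfolding monk_def Inf_less_iff Bex_def mem_Collect_eq by meson

lemma monk_Un_less:
  assumes "monk E \<rho> A < s" "monk E \<rho> B < s"
  shows "monk E \<rho> (A \<union> B) < s"
proof -
  obtain t F where t: "0 < t" "t < \<infinity>" "t < s" "finite F"
      "\<forall>C\<in>F. C \<subseteq> E \<and> \<rho> C \<le> t" "A \<subseteq> \<Union>F"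
    using assms(1) unfolding monk_less_iff by blast
  obtain u G where u: "0 < u" "u < \<infinity>" "u < s" "finite G"
      "\<forall>C\<in>G. C \<subseteq> E \<and> \<rho> C \<le> u" "B \<subseteq> \<Union>G"
    using assms(2) unfolding monk_less_iff by blast
  show ?thesis unfolding monk_less_iff
  proof (intro exI conjI)
    show "0 < max t u" "max t u < \<infinity>" "max t u < s" "finite (F \<union> G)" "A \<union> B \<subseteq> \<Union>(F \<union> G)"
      using t u by (auto simp: max_def)
    show "\<forall>C\<in>F \<union> G. C \<subseteq> E \<and> \<rho> C \<le> max t u"
      using t(5) u(5) by (auto simp: le_max_iff_disj)
  qed
qed

lemma monk_singleton_less:
  assumes "x \<in> E" "\<rho> {x} < s"
  shows "monk E \<rho> {x} < s"
proof -
  obtain t where t: "\<rho> {x} < t" "t < s" using dense assms(2) by blast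
  have "0 < t" using t(1) le_less_trans zero_le by blast
  moreover have "t < \<infinity>" using t(2) by (simp add: order_less_le_trans)
  moreover have "finite {{x}}" "\<forall>B\<in>{{x}}. B \<subseteq> E \<and> \<rho> B \<le> t" "{x} \<subseteq> \<Union>{{x}}"
    using assms(1) t(1) by auto
  ultimately show ?thesis unfolding monk_less_iff using t(2) by blast
qed

lemma bornology_bounded_subsets:
  assumes "size_function E \<rho>"
  shows "bornology E (bounded_subsets E \<rho>)"
proof -
  have sing: "monk E \<rho> {x} < \<infinity>" if "x \<in> E" for x
    using assms that monk_singleton_less[of x E \<rho> \<infinity>] unfolding size_function_def by simp
  have un: "monk E \<rho> (A \<union> B) < \<infinity>" if "monk E \<rho> A < \<infinity>" "monk E \<rho> B < \<infinity>" for A B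
    using that by (rule monk_Un_less)
  have sub: "monk E \<rho> A < \<infinity>" if "monk E \<rho> B < \<infinity>" "A \<subseteq> B" for A B
    using monk_mono[OF that(2)] that(1) by (rule le_less_trans)
  show ?thesis
  proof (rule bornologyI)
    show "B \<subseteq> E" if "B \<in> bounded_subsets E \<rho>" for B
      using that by (simp add: bounded_subsets_def)
    show "{x} \<in> bounded_subsets E \<rho>" if "x \<in> E" for x
      unfolding bounded_subsets_def using that sing[OF that] by blast
    show "A \<union> B \<in> bounded_subsets E \<rho>" if "A \<in> bounded_subsets E \<rho>" "B \<in> bounded_subsets E \<rho>" for A B
      unfolding bounded_subsets_def using that[unfolded bounded_subsets_def] un[of A B] by blast
    show "A \<in> bounded_subsets E \<rho>" if "B \<in> bounded_subsets E \<rho>" "A \<subseteq> B" for A B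
      unfolding bounded_subsets_def using that[unfolded bounded_subsets_def] sub[of B A] by blast
  qed
qed

lemma bornology_totally_bounded_subsets:
  assumes "size_function E \<rho>" "total_size E \<rho>"
  shows "bornology E (totally_bounded_subsets E \<rho>)"
proof -
  have zeroI: "a = 0" if "\<And>s. 0 < s \<Longrightarrow> a < s" for a :: ennreal
  proof (rule ccontr)
    assume "a \<noteq> 0"
    then have "0 < a" by (simp add: zero_less_iff_neq_zero)
    from that[OF this] show False by simp
  qed
  have sing: "monk E \<rho> {x} = 0" if "x \<in> E" for x
  proof (rule zeroI)
    fix s :: ennreal assume "0 < s"
    with assms(2) that show "monk E \<rho> {x} < s"
      by (intro monk_singleton_less) (simp_all add: total_size_def)
  qed
  have un: "monk E \<rho> (A \<union> B) = 0" if "monk E \<rho> A = 0" "monk E \<rho> B = 0" for A B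
  proof (rule zeroI)
    fix s :: ennreal assume "0 < s"
    with that show "monk E \<rho> (A \<union> B) < s"
      by (intro monk_Un_less) simp_all
  qed
  have sub: "monk E \<rho> A = 0" if "monk E \<rho> B = 0" "A \<subseteq> B" for A B
    using monk_mono[OF that(2), of E \<rho>] that(1) by simp
  show ?thesis
  proof (rule bornologyI)
    show "B \<subseteq> E" if "B \<in> totally_bounded_subsets E \<rho>" for B
      using that by (simp add: totally_bounded_subsets_def)
    show "{x} \<in> totally_bounded_subsets E \<rho>" if "x \<in> E" for x
      unfolding totally_bounded_subsets_def using that sing[OF that] by blast
    show "A \<union> B \<in> totally_bounded_subsets E \<rho>" if "A \<in> totally_bounded_subsets E \<rho>" "B \<in> totally_bounded_subsets E \<rho>" for A B
      unfolding totally_bounded_subsets_def using that[unfolded totally_bounded_subsets_def] un[of A B] by blast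
    show "A \<in> totally_bounded_subsets E \<rho>" if "B \<in> totally_bounded_subsets E \<rho>" "A \<subseteq> B" for A B
      unfolding totally_bounded_subsets_def using that[unfolded totally_bounded_subsets_def] sub[of B A] by blast
  qed
qed

end

theory Submission
  imports Defs
begin

text \<open>
  Weak outer-continuity is applied to singletons, which are compact in every space. Since
  \<open>\<rho> {x}\<close> is the infimum of the sizes of the open sets around \<open>x\<close>, any number above \<open>\<rho> {x}\<close> is
  above the size of some open neighbourhood of \<open>x\<close>: this is \<open>open_neighbourhood_of_small_size\<close>.

  Taking \<open>\<infinity>\<close> for that number, every point has open neighbourhoods of finite size, and by
  monotonicity they can be shrunk into any prescribed open set; a set of finite size is bounded,
  being covered by itself. If \<open>\<rho>\<close> is total, any positive number is allowed, so a compact set has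
  open covers by sets of arbitrarily small size, and finite subcovers of these show that it is
  totally bounded. In a locally compact space, intersecting a compact neighbourhood of a point with
  an open set around that point gives a totally bounded neighbourhood inside this open set.
\<close>

lemma monk_less_if_size_less:
  assumes "A \<subseteq> E" "\<rho> A < s"
  shows "monk E \<rho> A < s"
proof -
  \<comment> \<open>the size of \<open>A\<close> may vanish, while the numbers in the infimum defining the monk are positive\<close>
  obtain t where t: "\<rho> A < t" "t < s"
    using dense assms(2) by blast
  have "0 < t"
    using t(1) le_less_trans zero_le by blast
  moreover have "t < \<infinity>"
    using t(2) by (simp add: order_less_le_trans)
  moreover have "finite {A}" "\<forall>B\<in>{A}. B \<subseteq> E \<and> \<rho> B \<le> t" "A \<subseteq> \<Union>{A}"
    using assms(1) t(1) by auto
  ultimately show ?thesis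
    unfolding monk_less_iff using t(2) by blast
qed

lemma open_neighbourhood_of_small_size:
  assumes "weakly_outer_continuous X \<rho>" "x \<in> topspace X" "\<rho> {x} < s"
  obtains U where "openin X U" "x \<in> U" "\<rho> U < s"
proof -
  have "outer_size X \<rho> {x} < s"
    using assms by (simp add: weakly_outer_continuous_def)
  then show ?thesis
    unfolding outer_size_def INF_less_iff using that by auto
qed

text \<open>
  The points of \<open>K\<close> have open neighbourhoods of size below \<open>t\<close>, and a finite subcover of \<open>K\<close> by
  such neighbourhoods makes \<open>t\<close> one of the numbers in the infimum defining the monk.
\<close>

lemma monk_le_on_compact:
  assumes woc: "weakly_outer_continuous X \<rho>" and K: "compactin X K"
    and t: "0 < t" and small: "\<And>x. x \<in> K \<Longrightarrow> \<rho> {x} < t"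
  shows "monk (topspace X) \<rho> K \<le> t"
proof (cases "t < \<infinity>")
  case True
  define \<U> where "\<U> = {U. openin X U \<and> \<rho> U < t}"
  have "K \<subseteq> \<Union>\<U>"
  proof
    fix x assume x: "x \<in> K"
    then have "x \<in> topspace X"
      using compactin_subset_topspace[OF K] by blast
    then show "x \<in> \<Union>\<U>"
      using open_neighbourhood_of_small_size[OF woc _ small[OF x]] unfolding \<U>_def by blast
  qed
  then obtain \<F> where \<F>: "finite \<F>" "\<F> \<subseteq> \<U>" "K \<subseteq> \<Union>\<F>"
    using K unfolding compactin_def \<U>_def by (metis (no_types, lifting) mem_Collect_eq)
  have size: "B \<subseteq> topspace X \<and> \<rho> B \<le> t" if "B \<in> \<F>" for B
  proof -
    have "openin X B" "\<rho> B < t"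
      using \<F>(2) that unfolding \<U>_def by blast+
    then show ?thesis
      by (simp add: openin_subset)
  qed
  show ?thesis
    unfolding monk_def
  proof (intro Inf_lower CollectI conjI exI ballI)
    show "B \<subseteq> topspace X" "\<rho> B \<le> t" if "B \<in> \<F>" for B
      using size[OF that] by blast+
  qed (use t True \<F> in auto)
next
  case False
  then show ?thesis by (simp add: not_less top_unique)
qed

lemma relatively_compactin_totally_bounded:
  assumes woc: "weakly_outer_continuous X \<rho>" and tot: "total_size (topspace X) \<rho>"
    and A: "relatively_compactin X A"
  shows "A \<in> totally_bounded_subsets (topspace X) \<rho>"
proof -
  obtain K where K: "compactin X K" "A \<subseteq> K"
    using A unfolding relatively_compactin_def by blast
  have KX: "K \<subseteq> topspace X"
    using K(1) by (rule compactin_subset_topspace)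
  have "monk (topspace X) \<rho> K \<le> t" if "0 < t" for t
    using tot KX that by (intro monk_le_on_compact[OF woc K(1) that]) (auto simp: total_size_def)
  then have "monk (topspace X) \<rho> K \<le> 0"
    by (rule dense_ge)
  then have "monk (topspace X) \<rho> A = 0"
    using monk_mono[OF K(2), of "topspace X" \<rho>] by simp
  then show ?thesis
    using K(2) KX by (auto simp: totally_bounded_subsets_def)
qed

lemma locally_bounded_bounded_subsets:
  assumes size: "size_function (topspace X) \<rho>" and woc: "weakly_outer_continuous X \<rho>"
  shows "locally_bounded X (bounded_subsets (topspace X) \<rho>)"
  unfolding locally_bounded_def neighbourhood_base_of
proof (intro allI impI)
  fix W x assume W: "openin X W \<and> x \<in> W"
  then have x: "x \<in> topspace X"
    using openin_subset by blast
  then have "\<rho> {x} < \<infinity>"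
    using size by (simp add: size_function_def)
  then obtain U where U: "openin X U" "x \<in> U" "\<rho> U < \<infinity>"
    using open_neighbourhood_of_small_size[OF woc x] by blast
  have UX: "U \<subseteq> topspace X"
    using U(1) by (rule openin_subset)
  have "\<rho> (U \<inter> W) \<le> \<rho> U"
    using size UX by (simp add: size_function_def)
  then have "\<rho> (U \<inter> W) < \<infinity>"
    using U(3) by (rule le_less_trans)
  then have "monk (topspace X) \<rho> (U \<inter> W) < \<infinity>"
    using UX by (intro monk_less_if_size_less) auto
  then have "U \<inter> W \<in> bounded_subsets (topspace X) \<rho>"
    using UX by (auto simp: bounded_subsets_def)
  moreover have "openin X (U \<inter> W)"
    using U(1) W by blast
  ultimately show "\<exists>U V. openin X U \<and> V \<in> bounded_subsets (topspace X) \<rho> \<and>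
      x \<in> U \<and> U \<subseteq> V \<and> V \<subseteq> W"
    using U(2) W by blast
qed

text \<open>
  Without a separation axiom, local compactness provides just one compact neighbourhood of each
  point, perhaps none inside a given open set. One is enough: total boundedness, unlike compactness,
  passes to all subsets of that neighbourhood.
\<close>

lemma locally_bounded_totally_bounded_subsets:
  assumes woc: "weakly_outer_continuous X \<rho>" and tot: "total_size (topspace X) \<rho>"
    and lc: "locally_compact_space X"
  shows "locally_bounded X (totally_bounded_subsets (topspace X) \<rho>)"
  unfolding locally_bounded_def neighbourhood_base_of
proof (intro allI impI)
  fix W x assume W: "openin X W \<and> x \<in> W"
  then have "x \<in> topspace X"
    using openin_subset by blast
  then obtain U K where UK: "openin X U" "compactin X K" "x \<in> U" "U \<subseteq> K"
    using lc unfolding locally_compact_space_def by blast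
  have "relatively_compactin X (U \<inter> W)"
    using UK(2,4) unfolding relatively_compactin_def by blast
  then have "U \<inter> W \<in> totally_bounded_subsets (topspace X) \<rho>"
    by (rule relatively_compactin_totally_bounded[OF woc tot])
  moreover have "openin X (U \<inter> W)"
    using UK(1) W by blast
  ultimately show "\<exists>U V. openin X U \<and> V \<in> totally_bounded_subsets (topspace X) \<rho> \<and>
      x \<in> U \<and> U \<subseteq> V \<and> V \<subseteq> W"
    using UK(3) W by blast
qed

theorem theorem2p7:
  fixes X :: "'a topology" and \<rho> :: "'a set \<Rightarrow> ennreal"
  assumes "size_function (topspace X) \<rho>"
    and "weakly_outer_continuous X \<rho>"
  shows "locally_bounded X (bounded_subsets (topspace X) \<rho>) \<and>
    (total_size (topspace X) \<rho> \<longrightarrow>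
      (\<forall>A. relatively_compactin X A \<longrightarrow> A \<in> totally_bounded_subsets (topspace X) \<rho>)) \<and>
    (total_size (topspace X) \<rho> \<and> locally_compact_space X \<longrightarrow>
      locally_bounded X (totally_bounded_subsets (topspace X) \<rho>))"
proof (intro conjI impI allI)
  show "locally_bounded X (bounded_subsets (topspace X) \<rho>)"
    using assms by (rule locally_bounded_bounded_subsets)
next
  fix A assume "total_size (topspace X) \<rho>" "relatively_compactin X A"
  then show "A \<in> totally_bounded_subsets (topspace X) \<rho>"
    by (rule relatively_compactin_totally_bounded[OF assms(2)])
next
  assume "total_size (topspace X) \<rho> \<and> locally_compact_space X"
  then show "locally_bounded X (totally_bounded_subsets (topspace X) \<rho>)"
    using locally_bounded_totally_bounded_subsets[OF assms(2)] by blast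
qed

end
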